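(* Let $n \ge 1$ and let $h_1, \ldots, h_n > 0$ be growth rates with $\sum_{i=1}^n h_i = 1$. Consider the bamboo trimming process in which all bamboo start at height $0$, and in each time step every bamboo $b_i$ first grows by $h_i$ and then one bamboo is cut back to height $0$. If the cut bamboo is always chosen by the Reduce-Max algorithm (a tallest bamboo, measured after the growth of that step, is cut, ties broken arbitrarily), then no bamboo ever attains height $4$ or more; that is, the backlog is strictly less than $4$.
   Context: Bamboo trimming problem: there are $n$ bamboo $b_1,\dots,b_n$ with growth rates $h_1,\dots,h_n>0$, $\sum_i h_i = 1$, all of initial height $0$. Each time step consists of a growth phase (each $b_i$ grows by $h_i$) followed by a cut (the algorithm chooses one bamboo and sets its height to $0$). The backlog is the maximum height ever reached by any bamboo, where heights are considered at all times, including immediately after the growth phase and before the cut. *)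

theory Defs
  imports Complex_Main "HOL-Library.Extended_Real"
begin

text \<open>
  The bamboo are indexed by \<open>{1..n}\<close>, with growth rates \<open>h\<close>.  A run of a trimming algorithm is
  represented by the sequence \<open>c\<close> of its choices: \<open>c t\<close> is the bamboo cut in the time step leading
  from time \<open>t\<close> to time \<open>Suc t\<close>.  Arbitrary (even adaptive or history-dependent) tie-breaking
  is covered by quantifying over all admissible sequences \<open>c\<close>.
\<close>

primrec height :: "(nat \<Rightarrow> real) \<Rightarrow> (nat \<Rightarrow> nat) \<Rightarrow> nat \<Rightarrow> nat \<Rightarrow> real" where
  "height h c 0 i = 0"
| "height h c (Suc t) i = (if i = c t then 0 else height h c t i + h i)"

text \<open>\<open>height h c t\<close> is taken after \<open>t\<close> complete steps; \<open>grown_height h c t\<close> is taken in the next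
  step, after its growth phase and before its cut.\<close>

definition grown_height :: "(nat \<Rightarrow> real) \<Rightarrow> (nat \<Rightarrow> nat) \<Rightarrow> nat \<Rightarrow> nat \<Rightarrow> real" where
  "grown_height h c t i = height h c t i + h i"

definition reduce_max :: "nat \<Rightarrow> (nat \<Rightarrow> real) \<Rightarrow> (nat \<Rightarrow> nat) \<Rightarrow> bool" where
  "reduce_max n h c \<longleftrightarrow>
     (\<forall>t. c t \<in> {1..n} \<and> (\<forall>j\<in>{1..n}. grown_height h c t j \<le> grown_height h c t (c t)))"

definition attained_heights :: "nat \<Rightarrow> (nat \<Rightarrow> real) \<Rightarrow> (nat \<Rightarrow> nat) \<Rightarrow> real set" where
  "attained_heights n h c =
     {height h c t i | t i. i \<in> {1..n}} \<union> {grown_height h c t i | t i. i \<in> {1..n}}"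

text \<open>The supremum is taken in the extended reals, so an unbounded run has backlog \<open>\<infinity>\<close>.  For a
  bounded run with positive rates it is a maximum: every height of bamboo \<open>i\<close> is a natural
  multiple of \<open>h i\<close>, so only finitely many heights are attained.\<close>

definition backlog :: "nat \<Rightarrow> (nat \<Rightarrow> real) \<Rightarrow> (nat \<Rightarrow> nat) \<Rightarrow> ereal" where
  "backlog n h c = (SUP x\<in>attained_heights n h c. ereal x)"

end

theory Submission
  imports Defs
begin

text \<open>
  Suppose that the tallest bamboo has height at least 4 at step \<open>T\<close>, and let \<open>\<rho> s\<close> be the smallest
  rate among the bamboo cut in the steps \<open>s, \<dots>, T\<close>.  Going backwards in time, the tallest height
  shrinks by at most \<open>\<rho> s\<close> per step, because the slowest bamboo cut later has to be there already.
  As long as all cuts happen at height at least 2, at least half of the cuts in \<open>s, \<dots>, T\<close> hit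
  distinct bamboo, so that \<open>\<rho> s\<close> is at most the rate of the \<open>k\<close>-th new bamboo met backwards from
  \<open>T\<close>, where \<open>k\<close> is half the number of steps.  Hence the \<open>\<rho> s\<close> sum up to at most \<open>2 * (\<Sum>i. h i) = 2\<close>,
  the tallest height stays at least \<open>4 - 2 = 2\<close>, and this persists down to time 0, where all heights
  vanish.
\<close>

lemma height_uncut:
  assumes "t \<le> u" "\<And>v. t \<le> v \<Longrightarrow> v < u \<Longrightarrow> c v \<noteq> i"
  shows "height h c u i = height h c t i + real (u - t) * h i"
  using assms
proof (induction u rule: dec_induct)
  case (step u)
  then have "c u \<noteq> i" by auto
  moreover have "height h c u i = height h c t i + real (u - t) * h i"
    using step by auto
  ultimately show ?case
    using step.hyps by (simp add: Suc_diff_le algebra_simps)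
qed simp

text \<open>Confines each bamboo to a discrete grid of heights: with positive rates only finitely
  many of them lie below 4, which makes the backlog a maximum.\<close>

lemma height_multiple: "\<exists>k. height h c t i = real k * h i"
proof (induction t)
  case 0
  show ?case by (rule exI[of _ 0]) simp
next
  case (Suc t)
  then obtain k where "height h c t i = real k * h i" by blast
  then have "height h c (Suc t) i = real (if i = c t then 0 else Suc k) * h i"
    by (simp add: algebra_simps)
  then show ?case by blast
qed

text \<open>The total height of the bamboo already cut since step \<open>s\<close> grows by at most 1 per step, and a
  repeated cut lowers it by at least 2.\<close>

lemma distinct_cuts_ge_half:
  assumes A: "finite A" "\<And>i. i \<in> A \<Longrightarrow> h i \<ge> 0" "sum h A \<le> 1" "\<And>u. c u \<in> A"
    and high: "\<And>u. s \<le> u \<Longrightarrow> u < r \<Longrightarrow> grown_height h c u (c u) \<ge> 2"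
    and "s \<le> r"
  shows "real (r - s) \<le> 2 * real (card (c ` {s..<r}))"
proof -
  have nonneg: "height h c u i \<ge> 0" if "i \<in> A" for u i
    using A(2)[OF that] by (induction u) auto
  have bound: "(\<Sum>i\<in>c ` {s..<r}. height h c r i) + 2 * (real (r - s) - real (card (c ` {s..<r})))
      \<le> real (r - s)"
    using \<open>s \<le> r\<close> high
  proof (induction r rule: dec_induct)
    case (step u)
    define D where "D = c ` {s..<u}"
    have D: "finite D" "D \<subseteq> A" using A(4) by (auto simp: D_def)
    have IH: "(\<Sum>i\<in>D. height h c u i) + 2 * (real (u - s) - real (card D)) \<le> real (u - s)"
      using step unfolding D_def by auto
    have D': "c ` {s..<Suc u} = insert (c u) D"
      using step.hyps by (simp add: D_def atLeastLessThanSuc)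
    have "sum h D \<le> sum h A" by (rule sum_mono2) (use A D in auto)
    then have grow: "(\<Sum>i\<in>D. height h c u i + h i) \<le> (\<Sum>i\<in>D. height h c u i) + 1"
      using A(3) by (simp add: sum.distrib)
    have rest: "(\<Sum>i\<in>D - {c u}. height h c (Suc u) i) = (\<Sum>i\<in>D - {c u}. height h c u i + h i)"
      by (rule sum.cong) auto
    have new: "(\<Sum>i\<in>insert (c u) D. height h c (Suc u) i)
        = (\<Sum>i\<in>D - {c u}. height h c u i + h i)"
      unfolding rest[symmetric] using D(1) by (simp add: sum.insert_remove)
    have len: "real (Suc u - s) = real (u - s) + 1"
      using step.hyps by (simp add: Suc_diff_le)
    show ?case
    proof (cases "c u \<in> D")
      \<comment> \<open>A repeated cut takes a height of at least 2 out of the sum, which pays for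
        one more repetition counted with weight 2.\<close>
      case True
      then have "(\<Sum>i\<in>D. height h c u i + h i)
          = grown_height h c u (c u) + (\<Sum>i\<in>D - {c u}. height h c u i + h i)"
        using D(1) by (simp add: sum.remove grown_height_def)
      moreover have "grown_height h c u (c u) \<ge> 2" using step by auto
      moreover have "insert (c u) D = D" using True by auto
      ultimately show ?thesis
        using IH grow new len unfolding D' by simp
    next
      \<comment> \<open>A newly cut bamboo enters the sum at height 0, and the number of repetitions
        is unchanged.\<close>
      case False
      then have "D - {c u} = D" "card (insert (c u) D) = Suc (card D)" using D(1) by auto
      then show ?thesis
        using IH grow new len unfolding D' by simp
    qed
  qed simp
  have "(\<Sum>i\<in>c ` {s..<r}. height h c r i) \<ge> 0"
    using nonneg A(4) by (intro sum_nonneg) auto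
  then show ?thesis using bound by simp
qed

text \<open>The surplus \<open>2 * card D - L\<close> of distinct values over half of the length pays for the later
  steps at which no new value appears.\<close>

lemma sum_Min_le:
  fixes h :: "'a \<Rightarrow> real"
  assumes "t \<le> T"
    and half: "\<And>s. t \<le> s \<Longrightarrow> s \<le> T \<Longrightarrow> real (Suc T - s) \<le> 2 * real (card (c ` {s..T}))"
    and nonneg: "\<And>s. h (c s) \<ge> 0"
  shows "(\<Sum>s=t..T. Min (h ` c ` {s..T})) \<le> 2 * (\<Sum>i\<in>c ` {t..T}. h i)"
proof -
  define \<rho> where "\<rho> s = Min (h ` c ` {s..T})" for s
  have \<rho>_nonneg: "\<rho> s \<ge> 0" if "s \<le> T" for s
    unfolding \<rho>_def using that nonneg by (subst Min_ge_iff) auto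
  have "(\<Sum>s=t..T. \<rho> s) + (2 * real (card (c ` {t..T})) - real (Suc T - t)) * \<rho> t
      \<le> 2 * (\<Sum>i\<in>c ` {t..T}. h i)"
    using \<open>t \<le> T\<close> half
  proof (induction t rule: inc_induct)
    case base
    show ?case by (simp add: \<rho>_def)
  next
    case (step t)
    define D where "D = c ` {Suc t..T}"
    define L where "L = real (Suc T - Suc t)"
    have IH: "(\<Sum>s=Suc t..T. \<rho> s) + (2 * real (card D) - L) * \<rho> (Suc t) \<le> 2 * (\<Sum>i\<in>D. h i)"
      using step unfolding D_def L_def by auto
    have surplus: "L \<le> 2 * real (card D)"
      unfolding D_def L_def using step.prems[of "Suc t"] step.hyps by simp
    have fin: "finite D" and ne: "D \<noteq> {}" using step.hyps by (auto simp: D_def)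
    have D': "c ` {t..T} = insert (c t) D"
      using step.hyps by (simp add: D_def atLeastAtMost_insertL[symmetric])
    have len: "real (Suc T - t) = L + 1" using step.hyps by (simp add: L_def)
    have sum: "(\<Sum>s=t..T. \<rho> s) = \<rho> t + (\<Sum>s=Suc t..T. \<rho> s)"
      using step.hyps by (simp add: sum.atLeast_Suc_atMost)
    have \<rho>: "\<rho> t = min (h (c t)) (\<rho> (Suc t))"
      unfolding \<rho>_def D' D_def[symmetric] using fin ne by simp
    have mono: "(2 * real (card D) - L) * \<rho> t \<le> (2 * real (card D) - L) * \<rho> (Suc t)"
      using surplus \<rho> by (intro mult_left_mono) auto
    show ?case
    proof (cases "c t \<in> D")
      \<comment> \<open>The surplus drops by one, and the \<open>\<rho> t\<close> released in this
        way pays for the new summand.\<close>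
      case True
      then have "insert (c t) D = D" by auto
      then show ?thesis
        using IH mono sum len unfolding D' by (simp add: algebra_simps)
    next
      \<comment> \<open>The surplus rises by one; together with the new summand this costs
        \<open>2 * \<rho> t\<close>, covered by the \<open>2 * h (c t)\<close> gained on the
        right.\<close>
      case False
      then have "card (insert (c t) D) = Suc (card D)"
        "(\<Sum>i\<in>insert (c t) D. h i) = h (c t) + (\<Sum>i\<in>D. h i)"
        using fin by auto
      moreover have "\<rho> t \<le> h (c t)" using \<rho> by simp
      ultimately show ?thesis
        using IH mono sum len unfolding D' by (simp add: algebra_simps)
    qed
  qed
  moreover have "(2 * real (card (c ` {t..T})) - real (Suc T - t)) * \<rho> t \<ge> 0"
    using half[of t] \<rho>_nonneg[of t] \<open>t \<le> T\<close> by (intro mult_nonneg_nonneg) auto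
  ultimately show ?thesis by (simp add: \<rho>_def)
qed

text \<open>The witness is a slowest bamboo among those cut in the steps \<open>t\<close> to
  \<open>T\<close>. Followed back from its first cut there, it loses only its own rate per step, and
  this rate is at most each later minimum, since later minima range over fewer bamboo.\<close>

lemma exists_tall_before:
  fixes c :: "nat \<Rightarrow> nat"
  assumes "t \<le> T"
    and tall: "\<And>u. t \<le> u \<Longrightarrow> u \<le> T \<Longrightarrow>
      grown_height h c u (c u) \<ge> x - (\<Sum>s=Suc u..T. Min (h ` c ` {s..T}))"
  shows "\<exists>i \<in> c ` {t..T}. height h c t i \<ge> x - (\<Sum>s=t..T. Min (h ` c ` {s..T}))"
proof -
  define \<rho> where "\<rho> s = Min (h ` c ` {s..T})" for s
  have "\<rho> t \<in> h ` c ` {t..T}"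
    unfolding \<rho>_def using \<open>t \<le> T\<close> by (intro Min_in) auto
  then obtain w where w: "t \<le> w" "w \<le> T" "\<rho> t = h (c w)" by auto
  define i where "i = c w"
  define u where "u = (LEAST u. t \<le> u \<and> c u = i)"
  have u: "t \<le> u" "c u = i"
    using LeastI[of "\<lambda>u. t \<le> u \<and> c u = i" w] w by (auto simp: u_def i_def)
  have "u \<le> T"
    using Least_le[of "\<lambda>u. t \<le> u \<and> c u = i" w] w by (simp add: u_def i_def)
  have "height h c u i = height h c t i + real (u - t) * h i"
  proof (rule height_uncut)
    show "c v \<noteq> i" if "t \<le> v" "v < u" for v
      using not_less_Least[of v "\<lambda>u. t \<le> u \<and> c u = i"] that by (auto simp: u_def)
  qed (use u in auto)
  \<comment> \<open>The growth phase of step \<open>u\<close> itself counts too, so the number of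
    growths equals the number of summands over \<open>{t..u}\<close>.\<close>
  then have "height h c t i + real (Suc u - t) * h i = grown_height h c u (c u)"
    using u by (simp add: grown_height_def Suc_diff_le algebra_simps)
  also have "\<dots> \<ge> x - (\<Sum>s=Suc u..T. \<rho> s)"
    unfolding \<rho>_def using tall u \<open>u \<le> T\<close> by blast
  finally have low: "height h c t i + real (Suc u - t) * h i \<ge> x - (\<Sum>s=Suc u..T. \<rho> s)" .
  have "h i \<le> \<rho> s" if "t \<le> s" "s \<le> u" for s
    unfolding i_def w(3)[symmetric] \<rho>_def
    by (rule Min_antimono) (use that \<open>u \<le> T\<close> in auto)
  then have "real (card {t..u}) * h i \<le> (\<Sum>s=t..u. \<rho> s)"
    by (intro sum_bounded_below) auto
  moreover have "(\<Sum>s=t..T. \<rho> s) = (\<Sum>s=t..u. \<rho> s) + (\<Sum>s=Suc u..T. \<rho> s)"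
    using sum.ub_add_nat[of t u \<rho> "T - u"] u \<open>u \<le> T\<close> by simp
  ultimately have "height h c t i \<ge> x - (\<Sum>s=t..T. \<rho> s)"
    using low by simp
  then show ?thesis using w unfolding i_def \<rho>_def by auto
qed

lemma reduce_max_grown_height_less_4:
  assumes pos: "\<And>i. i \<in> {1..n} \<Longrightarrow> h i > 0"
    and total: "(\<Sum>i=1..n. h i) = 1"
    and rm: "reduce_max n h c"
  shows "grown_height h c T (c T) < 4"
proof (rule ccontr)
  assume "\<not> ?thesis"
  then have start: "grown_height h c T (c T) \<ge> 4" by simp
  define S where "S t = (\<Sum>s=t..T. Min (h ` c ` {s..T}))" for t
  \<comment> \<open>The two bounds are carried together: the bound 2 gives
    \<open>S t \<le> 2\<close> by counting distinct cuts, and then \<open>4 - S t\<close> returns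
    the bound 2 one step earlier. The sum starts at \<open>Suc u\<close>, so it is empty for
    \<open>u = T\<close>.\<close>
  define P where "P t \<longleftrightarrow> (\<forall>u\<in>{t..T}. grown_height h c u (c u) \<ge> 2 \<and>
    grown_height h c u (c u) \<ge> 4 - S (Suc u))" for t
  have cut: "c u \<in> {1..n}" "j \<in> {1..n} \<Longrightarrow> grown_height h c u j \<le> grown_height h c u (c u)"
    for u j using rm by (auto simp: reduce_max_def)
  have tall: "\<exists>i\<in>{1..n}. height h c t i \<ge> 2 \<and> height h c t i \<ge> 4 - S t" if "P t" "t \<le> T" for t
  proof -
    have half: "real (Suc T - s) \<le> 2 * real (card (c ` {s..T}))" if s: "t \<le> s" "s \<le> T" for s
    proof -
      have "real (Suc T - s) \<le> 2 * real (card (c ` {s..<Suc T}))"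
      proof (rule distinct_cuts_ge_half[where A = "{1..n}" and h = h])
        show "grown_height h c u (c u) \<ge> 2" if "s \<le> u" "u < Suc T" for u
          using \<open>P t\<close> that s by (auto simp: P_def)
      qed (use cut(1) total s less_imp_le[OF pos] in auto)
      then show ?thesis by (simp add: atLeastLessThanSuc_atLeastAtMost)
    qed
    have "S t \<le> 2 * (\<Sum>i\<in>c ` {t..T}. h i)"
      unfolding S_def using sum_Min_le[OF \<open>t \<le> T\<close> half] less_imp_le[OF pos[OF cut(1)]] by blast
    also have "(\<Sum>i\<in>c ` {t..T}. h i) \<le> (\<Sum>i=1..n. h i)"
      by (rule sum_mono2) (use cut(1) less_imp_le[OF pos] in auto)
    finally have "S t \<le> 2" using total by simp
    moreover have "\<exists>i\<in>c ` {t..T}. height h c t i \<ge> 4 - S t"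
      unfolding S_def
      by (rule exists_tall_before[OF \<open>t \<le> T\<close>]) (use \<open>P t\<close> in \<open>auto simp: P_def S_def\<close>)
    ultimately show ?thesis using cut(1) by force
  qed
  have "P 0"
  proof (rule inc_induct[of 0 T P])
    show "P T" using start by (simp add: P_def S_def)
  next
    fix t assume "t < T" "P (Suc t)"
    with tall[of "Suc t"] obtain i where i: "i \<in> {1..n}" "height h c (Suc t) i \<ge> 2"
      "height h c (Suc t) i \<ge> 4 - S (Suc t)" by auto
    \<comment> \<open>A positive height right after step \<open>t\<close> means that
      \<open>i\<close> was not cut in it; the bamboo that was cut is at least as tall by the
      Reduce-Max rule.\<close>
    then have "height h c (Suc t) i = grown_height h c t i"
      by (auto simp: grown_height_def split: if_splits)
    with i cut(2)[of i t] have "grown_height h c t (c t) \<ge> 2"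
      "grown_height h c t (c t) \<ge> 4 - S (Suc t)" by auto
    moreover have "{t..T} = insert t {Suc t..T}" using \<open>t < T\<close> by auto
    ultimately show "P t" using \<open>P (Suc t)\<close> by (simp add: P_def)
  qed simp
  from tall[OF this] show False by auto
qed

theorem theorem2p1:
  fixes n :: nat and h :: "nat \<Rightarrow> real" and c :: "nat \<Rightarrow> nat"
  assumes "n \<ge> 1"
    and "\<And>i. i \<in> {1..n} \<Longrightarrow> h i > 0"
    and "(\<Sum>i=1..n. h i) = 1"
    and "reduce_max n h c"
  shows "(\<forall>x\<in>attained_heights n h c. x < 4) \<and> backlog n h c < 4"
proof -
  let ?X = "attained_heights n h c"
  have grown: "grown_height h c t i < 4" if "i \<in> {1..n}" for t i
    using reduce_max_grown_height_less_4[OF assms(2-4), of t] assms(4) that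
    unfolding reduce_max_def by (meson le_less_trans)
  have less: "x < 4" if x: "x \<in> ?X" for x
  proof -
    obtain t i where i: "i \<in> {1..n}" "x = height h c t i \<or> x = grown_height h c t i"
      using x unfolding attained_heights_def by blast
    then show ?thesis
      using grown[OF i(1), of t] assms(2)[OF i(1)] by (auto simp: grown_height_def)
  qed
  \<comment> \<open>Heights below 4 alone would allow a supremum equal to 4; finiteness of
    \<open>?X\<close> keeps the inequality strict.\<close>
  have "?X \<subseteq> (\<Union>i\<in>{1..n}. (\<lambda>k. real k * h i) ` {..nat \<lceil>4 / h i\<rceil>})"
  proof
    fix x assume x: "x \<in> ?X"
    then obtain t i where i: "i \<in> {1..n}" "x = height h c t i \<or> x = height h c t i + h i"
      unfolding attained_heights_def grown_height_def by blast
    obtain k where "height h c t i = real k * h i" using height_multiple by blast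
    with i(2) have "x = real k * h i \<or> x = real (Suc k) * h i"
      by (auto simp: algebra_simps)
    then obtain m where m: "x = real m * h i" by blast
    then have "real m < 4 / h i"
      using less[OF x] assms(2)[OF i(1)] by (simp add: field_simps)
    then have "m \<le> nat \<lceil>4 / h i\<rceil>" by linarith
    with m i(1) show "x \<in> (\<Union>i\<in>{1..n}. (\<lambda>k. real k * h i) ` {..nat \<lceil>4 / h i\<rceil>})"
      by blast
  qed
  then have fin: "finite ?X" by (rule finite_subset) auto
  have ne: "?X \<noteq> {}" using assms(1) by (auto simp: attained_heights_def)
  have "backlog n h c = Max (ereal ` ?X)"
    unfolding backlog_def using fin ne by (subst Max_Sup) auto
  also have "\<dots> < 4"
    using fin ne less by (subst Max_less_iff) auto
  finally show ?thesis using less by blast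
qed

end
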